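(* Let $G$ and $H$ be two connected graphs, each with at least two vertices. Then the Cartesian product $G\Box H$ satisfies $CC(G\Box H)\geq \max\{CC(G)+k_G,\ CC(H)+k_H\}$, where $k_G$ and $k_H$ denote the number of full vertices in $G$ and $H$, respectively.
   Context: All graphs are finite and simple. The Cartesian product $G\Box H$ has vertex set $V(G)\times V(H)$, with $(u_1,v_1)$ and $(u_2,v_2)$ adjacent if either $u_1=u_2$ and $v_1$ is adjacent to $v_2$ in $H$, or $v_1=v_2$ and $u_1$ is adjacent to $u_2$ in $G$. A full vertex of $G$ is a vertex of degree $|V(G)|-1$. A set $S\subseteq V(G)$ is a dominating set of $G$ if every vertex of $V(G)\setminus S$ has a neighbour in $S$; it is a connected dominating set if moreover the induced subgraph $G[S]$ is connected. Two disjoint vertex sets $A_1,A_2$ form a connected coalition of $G$ if $A_1\cup A_2$ is a connected dominating set of $G$ but neither $A_1$ nor $A_2$ is a connected dominating set of $G$. A connected coalition partition of $G$ is a partition $\Phi$ of $V(G)$ (into nonempty sets) such that each $A\in\Phi$ either is $\{v\}$ for some full vertex $v$ of $G$, or forms a connected coalition of $G$ with another set in $\Phi$. The connected coalition number $CC(G)$ is the maximum cardinality of a connected coalition partition of $G$, with $CC(G)=0$ if none exists. *)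

theory Defs
  imports "HOL-Library.Disjoint_Sets" "Graph_Theory.Graph_Theory"
begin

text \<open>
  A finite simple graph is a \<open>pair_graph\<close> in the sense of the AFP entry: a finite vertex set
  \<open>pverts G\<close> with a symmetric irreflexive relation \<open>parcs G\<close> on it, so that the edge
  between \<open>u\<close> and \<open>v\<close> is represented by the two arcs \<open>(u, v)\<close> and \<open>(v, u)\<close>.
\<close>

definition cart_prod :: "'a pair_pre_digraph \<Rightarrow> 'b pair_pre_digraph \<Rightarrow> ('a \<times> 'b) pair_pre_digraph"
    (infixr \<open>\<box>\<close> 80) where
  "G \<box> H = \<lparr> pverts = pverts G \<times> pverts H,
     parcs = {((u1, v1), (u2, v2)) | u1 v1 u2 v2.
       (u1 = u2 \<and> u1 \<in> pverts G \<and> (v1, v2) \<in> parcs H) \<or>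
       (v1 = v2 \<and> v1 \<in> pverts H \<and> (u1, u2) \<in> parcs G)} \<rparr>"

text \<open>In a symmetric loop-free digraph without parallel arcs the out-degree is the degree.\<close>

definition full_vertex :: "'a pair_pre_digraph \<Rightarrow> 'a \<Rightarrow> bool" where
  "full_vertex G v \<longleftrightarrow> v \<in> pverts G \<and> out_degree (with_proj G) v = card (pverts G) - 1"

definition dominating_set :: "'a pair_pre_digraph \<Rightarrow> 'a set \<Rightarrow> bool" where
  "dominating_set G S \<longleftrightarrow> S \<subseteq> pverts G \<and> (\<forall>v \<in> pverts G - S. \<exists>u \<in> S. (v, u) \<in> parcs G)"

definition connected_dominating_set :: "'a pair_pre_digraph \<Rightarrow> 'a set \<Rightarrow> bool" where
  "connected_dominating_set G S \<longleftrightarrow> dominating_set G S \<and> connected (with_proj G \<restriction> S)"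

definition connected_coalition :: "'a pair_pre_digraph \<Rightarrow> 'a set \<Rightarrow> 'a set \<Rightarrow> bool" where
  "connected_coalition G A B \<longleftrightarrow>
     A \<subseteq> pverts G \<and> B \<subseteq> pverts G \<and> A \<inter> B = {} \<and>
     connected_dominating_set G (A \<union> B) \<and>
     \<not> connected_dominating_set G A \<and> \<not> connected_dominating_set G B"

definition connected_coalition_partition :: "'a pair_pre_digraph \<Rightarrow> 'a set set \<Rightarrow> bool" where
  "connected_coalition_partition G \<Phi> \<longleftrightarrow>
     partition_on (pverts G) \<Phi> \<and>
     (\<forall>A \<in> \<Phi>. (\<exists>v. full_vertex G v \<and> A = {v}) \<or>
               (\<exists>B \<in> \<Phi>. B \<noteq> A \<and> connected_coalition G A B))"

definition CC :: "'a pair_pre_digraph \<Rightarrow> nat" where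
  "CC G = (if \<exists>\<Phi>. connected_coalition_partition G \<Phi>
           then Max {card \<Phi> | \<Phi>. connected_coalition_partition G \<Phi>} else 0)"

lemma cart_prod_simps [simp]:
  "pverts (G \<box> H) = pverts G \<times> pverts H"
  "((u1, v1), (u2, v2)) \<in> parcs (G \<box> H) \<longleftrightarrow>
     (u1 = u2 \<and> u1 \<in> pverts G \<and> (v1, v2) \<in> parcs H) \<or>
     (v1 = v2 \<and> v1 \<in> pverts H \<and> (u1, u2) \<in> parcs G)"
  by (auto simp: cart_prod_def)

lemma pair_graph_cart_prod:
  assumes "pair_graph G" "pair_graph H"
  shows "pair_graph (G \<box> H)"
proof -
  interpret G: pair_graph G by fact
  interpret H: pair_graph H by fact
  have symG: "(u, v) \<in> parcs G \<Longrightarrow> (v, u) \<in> parcs G" for u v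
    using G.pair_sym_arcs by (auto simp: symmetric_def elim: symE)
  have symH: "(u, v) \<in> parcs H \<Longrightarrow> (v, u) \<in> parcs H" for u v
    using H.pair_sym_arcs by (auto simp: symmetric_def elim: symE)
  have sub: "parcs (G \<box> H) \<subseteq> pverts (G \<box> H) \<times> pverts (G \<box> H)"
    by (auto dest: G.in_arcsD1 G.in_arcsD2 H.in_arcsD1 H.in_arcsD2)
  have fin: "finite (pverts (G \<box> H))"
    using G.pair_finite_verts H.pair_finite_verts by simp
  show ?thesis
  proof
    show "finite (parcs (G \<box> H))"
      using sub fin by (meson finite_SigmaI finite_subset)
    show "symmetric (with_proj (G \<box> H))"
      by (auto simp: symmetric_def intro!: symI dest: symG symH)
    show "fst e \<noteq> snd e" if "e \<in> parcs (G \<box> H)" for e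
      using that G.pair_no_loops H.pair_no_loops by (cases e) fastforce
  qed (use sub fin in auto)
qed

lemma CC_attained:
  assumes "finite (pverts G)" "\<exists>\<Phi>. connected_coalition_partition G \<Phi>"
  shows "\<exists>\<Phi>. connected_coalition_partition G \<Phi> \<and> card \<Phi> = CC G"
proof -
  let ?S = "{card \<Phi> | \<Phi>. connected_coalition_partition G \<Phi>}"
  have "{\<Phi>. connected_coalition_partition G \<Phi>} \<subseteq> Pow (Pow (pverts G))"
    by (auto simp: connected_coalition_partition_def partition_on_def)
  then have "finite {\<Phi>. connected_coalition_partition G \<Phi>}"
    using assms(1) by (meson finite_Pow_iff finite_subset)
  then have "finite ?S" by simp
  moreover have "?S \<noteq> {}" using assms(2) by blast
  ultimately have "Max ?S \<in> ?S" by (rule Max_in)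
  then show ?thesis using assms(2) by (auto simp: CC_def)
qed

end

theory Submission
  imports Defs
begin

text \<open>
  If \<open>A\<close> and \<open>B\<close> form a connected coalition of \<open>G\<close>, then so do \<open>A \<times> V(H)\<close> and \<open>B \<times> V(H)\<close> in
  \<open>G \<box> H\<close>. For a full vertex \<open>v\<close> the fibre \<open>{v} \<times> V(H)\<close> is a connected dominating set, and cutting
  it into two nonempty pieces gives a connected coalition, because neither piece dominates the
  other fibres. So an optimal partition of \<open>G\<close> gains one set per full vertex.

  If \<open>G\<close> has no connected coalition partition, then it has a vertex that is not full. Let \<open>U\<close> be
  the set of these and \<open>v\<^sub>0\<close> a full vertex (without full vertices there is nothing to prove). The
  checkerboard sets \<open>{v\<^sub>0} \<times> {h} \<union> U \<times> (V(H) - {h})\<close> and \<open>{v\<^sub>0} \<times> (V(H) - {h}) \<union> U \<times> {h}\<close> are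
  disconnected and form a connected coalition, and the other full vertices again yield two sets each.
\<close>

section \<open>Graphs\<close>

lemma partition_on_Un:
  assumes "partition_on A P" and "partition_on B Q" and "disjnt A B"
  shows "partition_on (A \<union> B) (P \<union> Q)"
  using assms disjoint_union[of P Q] by (auto simp: partition_on_def disjnt_def)

text \<open>A finite vertex set has only finitely many partitions, so the \<open>Max\<close> in
  \<open>CC\<close> ranges over a finite set and is a genuine upper bound.\<close>

lemma card_le_CC:
  assumes "finite (pverts G)" and "connected_coalition_partition G \<Phi>"
  shows "card \<Phi> \<le> CC G"
proof -
  have "{\<Phi>. connected_coalition_partition G \<Phi>} \<subseteq> Pow (Pow (pverts G))"
    by (auto simp: connected_coalition_partition_def partition_on_def)
  then have "finite {\<Phi>. connected_coalition_partition G \<Phi>}"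
    using assms(1) by (meson finite_Pow_iff finite_subset)
  then have "finite {card \<Phi> | \<Phi>. connected_coalition_partition G \<Phi>}"
    by simp
  moreover have "CC G = Max {card \<Phi> | \<Phi>. connected_coalition_partition G \<Phi>}"
    unfolding CC_def using assms(2) by metis
  ultimately show ?thesis
    using assms(2) by (auto intro: Max_ge)
qed

lemma connected_coalition_commute:
  "connected_coalition G A B \<longleftrightarrow> connected_coalition G B A"
  unfolding connected_coalition_def by (metis Int_commute Un_commute)

context pair_graph
begin

section \<open>Connectivity of induced subgraphs through sets closed under adjacency\<close>

lemma arcs_sym: "(u, v) \<in> parcs G \<Longrightarrow> (v, u) \<in> parcs G"
  using pair_sym_arcs by (auto simp: symmetric_def elim: symE)

text \<open>A set closed under adjacency inside \<open>S\<close> absorbs every walk that starts in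
  it; conversely, the vertices reachable from \<open>u\<close> form such a closed set. All later
  connectivity arguments use this criterion instead of walks.\<close>

lemma connected_induce_iff:
  "connected (with_proj G \<restriction> S) \<longleftrightarrow>
     S \<noteq> {} \<and> (\<forall>P. P \<subseteq> S \<and> P \<noteq> {} \<and> (\<forall>u\<in>P. \<forall>v\<in>S. (u, v) \<in> parcs G \<longrightarrow> v \<in> P) \<longrightarrow> P = S)"
proof -
  let ?R = "{(u, v). (u, v) \<in> parcs G \<and> u \<in> S \<and> v \<in> S}"
  let ?reach = "\<lambda>u. {v. (u, v) \<in> rtrancl_on S ?R}"
  \<comment> \<open>Arcs already come in both directions, so \<open>mk_symmetric\<close> adds
    nothing and plain reachability along \<open>?R\<close> remains.\<close>
  have "parcs (mk_symmetric (with_proj G \<restriction> S)) = ?R"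
    by (auto simp: mk_symmetric_def intro: arcs_sym)
  moreover have "pverts (mk_symmetric (with_proj G \<restriction> S)) = S"
    by (simp add: mk_symmetric_def)
  ultimately have conn: "connected (with_proj G \<restriction> S) \<longleftrightarrow>
      S \<noteq> {} \<and> (\<forall>u\<in>S. \<forall>v\<in>S. (u, v) \<in> rtrancl_on S ?R)"
    by (simp add: connected_def strongly_connected_def reachable_def)
  show ?thesis
  proof (cases "S = {}")
    case True
    then show ?thesis unfolding conn by blast
  next
    case False
    have "P = S" if all: "\<forall>u\<in>S. \<forall>v\<in>S. (u, v) \<in> rtrancl_on S ?R"
      and P: "P \<subseteq> S" "u \<in> P" "\<forall>u\<in>P. \<forall>v\<in>S. (u, v) \<in> parcs G \<longrightarrow> v \<in> P" for P u
    proof -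
      have "v \<in> P" if "(u, v) \<in> rtrancl_on S ?R" for v
        using that by (induct rule: rtrancl_on_induct) (use P in auto)
      then show ?thesis using all P by blast
    qed
    moreover have "(u, v) \<in> rtrancl_on S ?R" if "u \<in> S" "v \<in> S"
      and cut: "\<forall>P. P \<subseteq> S \<and> P \<noteq> {} \<and> (\<forall>u\<in>P. \<forall>v\<in>S. (u, v) \<in> parcs G \<longrightarrow> v \<in> P) \<longrightarrow> P = S" for u v
    proof -
      have "?reach u \<subseteq> S" by (auto dest: in_rtrancl_on_in_F)
      moreover have "u \<in> ?reach u" using that by simp
      moreover have "\<forall>x\<in>?reach u. \<forall>y\<in>S. (x, y) \<in> parcs G \<longrightarrow> y \<in> ?reach u"
        by (auto dest: in_rtrancl_on_in_F intro: rtrancl_on_into_rtrancl_on)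
      ultimately have "?reach u = S"
        using cut by blast
      then show ?thesis using \<open>v \<in> S\<close> by blast
    qed
    ultimately show ?thesis unfolding conn using False by blast
  qed
qed

lemma connected_induceI:
  assumes "S \<noteq> {}"
    and "\<And>P w. \<lbrakk>P \<subseteq> S; w \<in> P; \<And>u v. \<lbrakk>u \<in> P; v \<in> S; (u, v) \<in> parcs G\<rbrakk> \<Longrightarrow> v \<in> P\<rbrakk> \<Longrightarrow> S \<subseteq> P"
  shows "connected (with_proj G \<restriction> S)"
  unfolding connected_induce_iff
proof (intro conjI allI impI assms(1))
  fix P assume *: "P \<subseteq> S \<and> P \<noteq> {} \<and> (\<forall>u\<in>P. \<forall>v\<in>S. (u, v) \<in> parcs G \<longrightarrow> v \<in> P)"
  then obtain w where "w \<in> P" by blast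
  then have "S \<subseteq> P" using assms(2)[of P w] * by blast
  then show "P = S" using * by blast
qed

lemma connected_induceD:
  assumes "connected (with_proj G \<restriction> S)" and "P \<subseteq> S" and "w \<in> P"
    and "\<And>u v. \<lbrakk>u \<in> P; v \<in> S; (u, v) \<in> parcs G\<rbrakk> \<Longrightarrow> v \<in> P"
  shows "P = S"
  using assms unfolding connected_induce_iff by blast

text \<open>Makes the criterion, which speaks of induced subgraphs, applicable to a whole connected
  graph.\<close>

lemma induce_pverts: "with_proj G \<restriction> pverts G = with_proj G"
  unfolding induce_subgraph_def with_proj_def
  by (auto intro: arc_fst_in_verts arc_snd_in_verts)

section \<open>Full vertices\<close>

lemma full_vertexD:
  assumes "full_vertex G v" and "u \<in> pverts G" and "u \<noteq> v"
  shows "(v, u) \<in> parcs G"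
proof -
  let ?N = "{w. (v, w) \<in> parcs G}"
  have "out_arcs (with_proj G) v = Pair v ` ?N"
    by (auto simp: out_arcs_def)
  then have "card ?N = card (pverts G) - 1"
    using assms(1) by (simp add: full_vertex_def out_degree_def card_image inj_on_def)
  moreover have "card (pverts G - {v}) = card (pverts G) - 1"
    using assms(1) by (simp add: full_vertex_def)
  moreover have "?N \<subseteq> pverts G - {v}"
    using pair_no_loops in_arcsD2 by fastforce
  \<comment> \<open>The neighbourhood lies in \<open>pverts G - {v}\<close> and has the same finite
    cardinality, so the two sets coincide.\<close>
  ultimately have "?N = pverts G - {v}"
    by (metis card_subset_eq finite_Diff pair_finite_verts)
  then show ?thesis using assms by blast
qed

lemma full_vertex_in_pverts: "full_vertex G v \<Longrightarrow> v \<in> pverts G"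
  by (simp add: full_vertex_def)

lemma finite_full_vertices: "finite {v. full_vertex G v}"
  using pair_finite_verts by (rule rev_finite_subset) (auto simp: full_vertex_def)

text \<open>The vertex \<open>v\<close> is the centre of a star spanning \<open>S\<close>: a
  nonempty closed set reaches \<open>v\<close> from any of its members, and everything else from
  \<open>v\<close>. Hence no set containing a full vertex can be a member of a coalition.\<close>

lemma connected_dominating_set_full:
  assumes v: "full_vertex G v" and S: "v \<in> S" "S \<subseteq> pverts G"
  shows "connected_dominating_set G S"
proof -
  have "(u, v) \<in> parcs G" if "u \<in> pverts G" "u \<noteq> v" for u
    using full_vertexD[OF v that] by (rule arcs_sym)
  then have "dominating_set G S"
    using S by (auto simp: dominating_set_def)
  moreover have "connected (with_proj G \<restriction> S)"
  proof (rule connected_induceI)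
    fix P w assume P: "P \<subseteq> S" "w \<in> P" "\<And>x y. \<lbrakk>x \<in> P; y \<in> S; (x, y) \<in> parcs G\<rbrakk> \<Longrightarrow> y \<in> P"
    have "v \<in> P"
      using P(3)[OF P(2) S(1)] P(1,2) S full_vertexD[OF v, of w] arcs_sym by (cases "w = v") auto
    then show "S \<subseteq> P"
      using P(3)[of v] S full_vertexD[OF v] by (metis subset_iff)
  qed (use S in blast)
  ultimately show ?thesis by (simp add: connected_dominating_set_def)
qed

end

section \<open>Cartesian products\<close>

text \<open>The assumptions are symmetric, while the bounds proved inside concern the left factor;
  interpreting the locale in both orders covers both terms of the maximum.\<close>

locale graph_pair = G: pair_graph G + H: pair_graph H
  for G :: "'a pair_pre_digraph" and H :: "'b pair_pre_digraph" +
  assumes connG: "connected (with_proj G)" and connH: "connected (with_proj H)"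
    and cardG: "card (pverts G) \<ge> 2" and cardH: "card (pverts H) \<ge> 2"
begin

sublocale P: pair_graph "G \<box> H"
  by (rule pair_graph_cart_prod) unfold_locales

lemma other_G: obtains u where "u \<in> pverts G" "u \<noteq> v"
proof -
  have "\<not> pverts G \<subseteq> {v}"
    using cardG card_mono[of "{v}" "pverts G"] by auto
  then show ?thesis using that by blast
qed

lemma nonempty_H: "pverts H \<noteq> {}"
  using cardH by auto

text \<open>If \<open>A\<close> is connected, a nonempty closed set \<open>Q\<close> first fills one
  fibre over \<open>a\<close>, by connectivity of \<open>H\<close>, and then every layer at a fixed
  \<open>y\<close>, by connectivity of \<open>A\<close>. Conversely, a closed \<open>Q\<close>
  inside \<open>A\<close> lifts to the closed set \<open>Q \<times> pverts H\<close>.\<close>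

lemma connected_times:
  assumes A: "A \<subseteq> pverts G"
  shows "connected (with_proj (G \<box> H) \<restriction> (A \<times> pverts H)) \<longleftrightarrow> connected (with_proj G \<restriction> A)"
proof
  assume conn: "connected (with_proj G \<restriction> A)"
  show "connected (with_proj (G \<box> H) \<restriction> (A \<times> pverts H))"
  proof (rule P.connected_induceI)
    show "A \<times> pverts H \<noteq> {}"
      using conn nonempty_H by (auto simp: G.connected_induce_iff)
    fix Q w
    assume Q: "Q \<subseteq> A \<times> pverts H" "w \<in> Q"
      "\<And>u v. \<lbrakk>u \<in> Q; v \<in> A \<times> pverts H; (u, v) \<in> parcs (G \<box> H)\<rbrakk> \<Longrightarrow> v \<in> Q"
    obtain a b where w: "w = (a, b)" by force
    have "{y \<in> pverts H. (a, y) \<in> Q} = pverts H"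
    proof (rule H.connected_induceD)
      show "connected (with_proj H \<restriction> pverts H)" using connH by (simp add: H.induce_pverts)
      show "b \<in> {y \<in> pverts H. (a, y) \<in> Q}" using Q w by auto
      fix u v
      assume "u \<in> {y \<in> pverts H. (a, y) \<in> Q}" "v \<in> pverts H" "(u, v) \<in> parcs H"
      then show "v \<in> {y \<in> pverts H. (a, y) \<in> Q}"
        using Q(3)[of "(a, u)" "(a, v)"] Q(1) A by auto
    qed simp
    moreover have "{x \<in> A. (x, y) \<in> Q} = A" if "(a, y) \<in> Q" for y
      using conn
    proof (rule G.connected_induceD)
      show "a \<in> {x \<in> A. (x, y) \<in> Q}" using Q that by auto
      fix u v
      assume "u \<in> {x \<in> A. (x, y) \<in> Q}" "v \<in> A" "(u, v) \<in> parcs G"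
      then show "v \<in> {x \<in> A. (x, y) \<in> Q}"
        using Q(3)[of "(u, y)" "(v, y)"] Q(1) A by auto
    qed simp
    ultimately show "A \<times> pverts H \<subseteq> Q" by blast
  qed
next
  assume conn: "connected (with_proj (G \<box> H) \<restriction> (A \<times> pverts H))"
  show "connected (with_proj G \<restriction> A)"
  proof (rule G.connected_induceI)
    show "A \<noteq> {}" using conn by (auto simp: P.connected_induce_iff)
    fix Q w
    assume Q: "Q \<subseteq> A" "w \<in> Q" "\<And>u v. \<lbrakk>u \<in> Q; v \<in> A; (u, v) \<in> parcs G\<rbrakk> \<Longrightarrow> v \<in> Q"
    obtain h where "h \<in> pverts H" using nonempty_H by blast
    have "Q \<times> pverts H = A \<times> pverts H"
      using conn by (rule P.connected_induceD[where w = "(w, h)"])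
        (use Q \<open>h \<in> pverts H\<close> in auto)
    then show "A \<subseteq> Q" using nonempty_H by blast
  qed
qed

lemma dominating_set_times:
  assumes A: "A \<subseteq> pverts G"
  shows "dominating_set (G \<box> H) (A \<times> pverts H) \<longleftrightarrow> dominating_set G A"
proof
  assume "dominating_set G A"
  then show "dominating_set (G \<box> H) (A \<times> pverts H)"
    by (fastforce simp: dominating_set_def)
next
  assume dom: "dominating_set (G \<box> H) (A \<times> pverts H)"
  obtain h where h: "h \<in> pverts H" using nonempty_H by blast
  show "dominating_set G A"
    unfolding dominating_set_def
  proof (intro conjI ballI A)
    fix v assume v: "v \<in> pverts G - A"
    then have "(v, h) \<in> pverts (G \<box> H) - A \<times> pverts H" using h by auto
    then obtain x where "x \<in> A \<times> pverts H" "((v, h), x) \<in> parcs (G \<box> H)"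
      using dom unfolding dominating_set_def by blast
    \<comment> \<open>Since \<open>v\<close> is outside \<open>A\<close>, the edge to
      \<open>x\<close> changes the first coordinate, so it comes from an edge of
      \<open>G\<close>.\<close>
    then show "\<exists>u\<in>A. (v, u) \<in> parcs G" using v by auto
  qed
qed

lemma connected_dominating_set_times:
  assumes "A \<subseteq> pverts G"
  shows "connected_dominating_set (G \<box> H) (A \<times> pverts H) \<longleftrightarrow> connected_dominating_set G A"
  using assms by (simp add: connected_dominating_set_def connected_times dominating_set_times)

text \<open>Both directions of the preceding equivalence enter: one for the union, the other for the
  two sets that must fail.\<close>

lemma connected_coalition_times:
  assumes "connected_coalition G A B"
  shows "connected_coalition (G \<box> H) (A \<times> pverts H) (B \<times> pverts H)"
  using assms unfolding connected_coalition_def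
  by (auto simp: connected_dominating_set_times simp flip: Sigma_Un_distrib1)

lemma not_dominating_subset_fibre:
  assumes "h \<in> pverts H - B"
  shows "\<not> dominating_set (G \<box> H) ({v} \<times> B)"
proof -
  obtain u where "u \<in> pverts G" "u \<noteq> v" by (rule other_G)
  \<comment> \<open>The only possible neighbour of \<open>(u, h)\<close> in the fibre over
    \<open>v\<close> is \<open>(v, h)\<close>, which is missing because \<open>h\<close> is not in
    \<open>B\<close>.\<close>
  then have "(u, h) \<in> pverts (G \<box> H) - {v} \<times> B" using assms by auto
  moreover have "\<not> (\<exists>x\<in>{v} \<times> B. ((u, h), x) \<in> parcs (G \<box> H))"
    using assms \<open>u \<noteq> v\<close> by auto
  ultimately show ?thesis unfolding dominating_set_def by blast
qed

lemma connected_coalition_fibre: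
  assumes v: "full_vertex G v" and "B \<union> C = pverts H" "B \<inter> C = {}" "B \<noteq> {}" "C \<noteq> {}"
  shows "connected_coalition (G \<box> H) ({v} \<times> B) ({v} \<times> C)"
proof -
  have "connected_dominating_set (G \<box> H) ({v} \<times> pverts H)"
    using G.connected_dominating_set_full[OF v] G.full_vertex_in_pverts[OF v]
    by (simp add: connected_dominating_set_times)
  moreover have "{v} \<times> B \<union> {v} \<times> C = {v} \<times> pverts H"
    using assms by blast
  moreover have "\<not> dominating_set (G \<box> H) ({v} \<times> B)" "\<not> dominating_set (G \<box> H) ({v} \<times> C)"
    using assms not_dominating_subset_fibre by (metis Diff_iff Un_iff disjoint_iff ex_in_conv)+
  ultimately show ?thesis
    using assms G.full_vertex_in_pverts[OF v]
    by (auto simp: connected_coalition_def connected_dominating_set_def)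
qed

lemma connected_coalition_checkerboard:
  assumes v: "full_vertex G v" and U: "U \<subseteq> pverts G" "v \<notin> U" "U \<noteq> {}"
    and BC: "B \<union> C = pverts H" "B \<inter> C = {}" "B \<noteq> {}" "C \<noteq> {}"
  shows "connected_coalition (G \<box> H) ({v} \<times> B \<union> U \<times> C) ({v} \<times> C \<union> U \<times> B)"
proof -
  have vG: "v \<in> pverts G" using v by (rule G.full_vertex_in_pverts)
  \<comment> \<open>Stated for arbitrary \<open>B'\<close> and \<open>C'\<close>, so that exchanging
    \<open>B\<close> and \<open>C\<close> gives the second set as well.\<close>
  have "\<not> connected (with_proj (G \<box> H) \<restriction> ({v} \<times> B' \<union> U \<times> C'))"
    if "B' \<union> C' = pverts H" "B' \<inter> C' = {}" "B' \<noteq> {}" "C' \<noteq> {}" for B' C'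
  proof
    assume conn: "connected (with_proj (G \<box> H) \<restriction> ({v} \<times> B' \<union> U \<times> C'))"
    obtain b where "b \<in> B'" using \<open>B' \<noteq> {}\<close> by blast
    \<comment> \<open>An edge of the product changes exactly one coordinate, whereas passing from
      \<open>{v} \<times> B'\<close> to \<open>U \<times> C'\<close> changes both. So
      \<open>{v} \<times> B'\<close> is closed.\<close>
    have "{v} \<times> B' = {v} \<times> B' \<union> U \<times> C'"
      using conn by (rule P.connected_induceD[where w = "(v, b)"])
        (use that U \<open>b \<in> B'\<close> in auto)
    then show False using that U by blast
  qed
  then have "\<not> connected (with_proj (G \<box> H) \<restriction> ({v} \<times> B \<union> U \<times> C))"
    "\<not> connected (with_proj (G \<box> H) \<restriction> ({v} \<times> C \<union> U \<times> B))"
    using BC by (simp_all add: Un_commute Int_commute)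
  moreover have "({v} \<times> B \<union> U \<times> C) \<union> ({v} \<times> C \<union> U \<times> B) = insert v U \<times> pverts H"
    using BC by blast
  moreover have "connected_dominating_set (G \<box> H) (insert v U \<times> pverts H)"
    using G.connected_dominating_set_full[OF v, of "insert v U"] U vG
    by (simp add: connected_dominating_set_times)
  ultimately show ?thesis
    using BC U vG by (auto simp: connected_coalition_def connected_dominating_set_def)
qed

text \<open>The count shared by both cases: the fibres over \<open>F\<close> give two classes each,
  and \<open>\<Psi>\<close> handles the rest of the product with partners of its own.\<close>

lemma card_plus_fibres_le_CC:
  assumes F: "\<And>v. v \<in> F \<Longrightarrow> full_vertex G v"
    and part: "partition_on ((pverts G - F) \<times> pverts H) \<Psi>"
    and coal: "\<And>A. A \<in> \<Psi> \<Longrightarrow> \<exists>B\<in>\<Psi>. B \<noteq> A \<and> connected_coalition (G \<box> H) A B"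
  shows "card \<Psi> + 2 * card F \<le> CC (G \<box> H)"
proof -
  obtain h where h: "h \<in> pverts H" using nonempty_H by blast
  define B where "B = {h}"
  define C where "C = pverts H - {h}"
  \<comment> \<open>Here two vertices of \<open>H\<close> are needed: the cut into one vertex and
    the remainder must have two nonempty sides.\<close>
  have "card C \<ge> 1" using cardH h H.pair_finite_verts by (simp add: C_def)
  then have "C \<noteq> {}" by auto
  then have BC: "B \<union> C = pverts H" "B \<inter> C = {}" "B \<noteq> {}" "C \<noteq> {}" "B \<noteq> C"
    using h by (auto simp: B_def C_def)
  have FG: "F \<subseteq> pverts G" using F G.full_vertex_in_pverts by blast
  define \<Theta> where "\<Theta> = (\<lambda>(v, D). {v} \<times> D) ` (F \<times> {B, C})"
  have partF: "partition_on (F \<times> pverts H) \<Theta>"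
    by (rule partition_onI) (use BC in \<open>auto simp: \<Theta>_def disjnt_def\<close>)
  have "inj_on (\<lambda>(v, D). {v} \<times> D) (F \<times> {B, C})"
    using BC(3,4) by (fastforce simp: inj_on_def times_eq_iff)
  then have card: "card \<Theta> = 2 * card F"
    using BC by (simp add: \<Theta>_def card_image card_cartesian_product)
  have "partition_on ((pverts G - F) \<times> pverts H \<union> F \<times> pverts H) (\<Psi> \<union> \<Theta>)"
    using part partF by (rule partition_on_Un) (auto simp: disjnt_def)
  moreover have "(pverts G - F) \<times> pverts H \<union> F \<times> pverts H = pverts (G \<box> H)"
    using FG by auto
  moreover have "\<exists>E\<in>\<Theta>. E \<noteq> A \<and> connected_coalition (G \<box> H) A E" if A: "A \<in> \<Theta>" for A
  proof -
    obtain v where v: "v \<in> F" "A = {v} \<times> B \<or> A = {v} \<times> C" using A by (auto simp: \<Theta>_def)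
    have "connected_coalition (G \<box> H) ({v} \<times> B) ({v} \<times> C)"
      using v F BC by (blast intro: connected_coalition_fibre)
    moreover have "{v} \<times> B \<in> \<Theta>" "{v} \<times> C \<in> \<Theta>" using v by (auto simp: \<Theta>_def)
    moreover have "{v} \<times> B \<noteq> {v} \<times> C" using BC by blast
    ultimately show ?thesis using v connected_coalition_commute by metis
  qed
  \<comment> \<open>Every class has a coalition partner, so the full-vertex alternative of the
    definition is never invoked in the product.\<close>
  ultimately have "connected_coalition_partition (G \<box> H) (\<Psi> \<union> \<Theta>)"
    using coal unfolding connected_coalition_partition_def by (metis Un_iff)
  then have "card (\<Psi> \<union> \<Theta>) \<le> CC (G \<box> H)"
    using P.pair_finite_verts by (rule card_le_CC[rotated])
  moreover have "\<Psi> \<inter> \<Theta> = {}"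
  proof (rule ccontr)
    assume "\<Psi> \<inter> \<Theta> \<noteq> {}"
    then obtain A where A: "A \<in> \<Psi>" "A \<in> \<Theta>" by blast
    then have "A \<subseteq> (pverts G - F) \<times> pverts H" "A \<subseteq> F \<times> pverts H"
      using part partF by (auto simp: partition_on_def)
    then have "A = {}" by blast
    then show False using A part by (simp add: partition_on_def)
  qed
  moreover have "finite \<Psi>"
    using G.pair_finite_verts H.pair_finite_verts by (intro finite_elements[OF _ part]) simp
  moreover have "finite \<Theta>"
    using finite_subset[OF FG G.pair_finite_verts] by (simp add: \<Theta>_def)
  ultimately show ?thesis using card by (simp add: card_Un_disjoint)
qed

text \<open>With \<open>k\<close> full vertices, exactly \<open>k\<close> classes of
  \<open>\<Phi>\<close> are the singletons of full vertices. The other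
  \<open>card \<Phi> - k\<close> classes lift to the product, and the fibres over full vertices give
  \<open>2 * k\<close> more, in total \<open>card \<Phi> + k\<close>.\<close>

lemma CC_plus_full_le_CC_of_partition:
  assumes "connected_coalition_partition G \<Phi>"
  shows "card \<Phi> + card {v. full_vertex G v} \<le> CC (G \<box> H)"
proof -
  let ?F = "{v. full_vertex G v}"
  let ?S = "(\<lambda>v. {v}) ` ?F"
  have part: "partition_on (pverts G) \<Phi>"
    and cases: "\<And>A. A \<in> \<Phi> \<Longrightarrow> A \<in> ?S \<or> (\<exists>B\<in>\<Phi>. B \<noteq> A \<and> connected_coalition G A B)"
    using assms by (auto simp: connected_coalition_partition_def)
  \<comment> \<open>A class containing a full vertex is already a connected dominating set, which
    rules out a coalition and leaves only the singleton alternative.\<close>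
  have full: "A = {v}" if "A \<in> \<Phi>" "v \<in> A" "full_vertex G v" for A v
  proof -
    have "A \<subseteq> pverts G" using part that by (auto simp: partition_on_def)
    then have "connected_dominating_set G A"
      using that by (blast intro: G.connected_dominating_set_full)
    then show ?thesis using cases[OF that(1)] that by (auto simp: connected_coalition_def)
  qed
  have S: "?S \<subseteq> \<Phi>"
  proof clarify
    fix v assume v: "full_vertex G v"
    then obtain A where "A \<in> \<Phi>" "v \<in> A"
      using part G.full_vertex_in_pverts by (auto simp: partition_on_def)
    then show "{v} \<in> \<Phi>" using full v by blast
  qed
  let ?\<Psi> = "(\<lambda>A. A \<times> pverts H) ` (\<Phi> - ?S)"
  have Un: "\<Union>(\<Phi> - ?S) = pverts G - ?F"
  proof
    show "\<Union>(\<Phi> - ?S) \<subseteq> pverts G - ?F"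
      using part full by (fastforce simp: partition_on_def)
    show "pverts G - ?F \<subseteq> \<Union>(\<Phi> - ?S)"
      using part by (auto simp: partition_on_def)
  qed
  have inj: "inj_on (\<lambda>A. A \<times> pverts H) (\<Phi> - ?S)"
    using nonempty_H by (auto simp: inj_on_def times_eq_iff)
  have "card ?\<Psi> + 2 * card ?F \<le> CC (G \<box> H)"
  proof (rule card_plus_fibres_le_CC)
    show "partition_on ((pverts G - ?F) \<times> pverts H) ?\<Psi>"
    proof (rule partition_onI)
      show "\<Union>?\<Psi> = (pverts G - ?F) \<times> pverts H" using Un by blast
      show "{} \<notin> ?\<Psi>" using part nonempty_H by (auto simp: partition_on_def eq_commute[of "{}"])
      show "disjnt p q" if "p \<in> ?\<Psi>" "q \<in> ?\<Psi>" "p \<noteq> q" for p q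
        using that part unfolding partition_on_def disjoint_def disjnt_def by blast
    qed
  next
    fix A' assume "A' \<in> ?\<Psi>"
    then obtain A where A: "A \<in> \<Phi>" "A \<notin> ?S" "A' = A \<times> pverts H" by blast
    then obtain B where B: "B \<in> \<Phi>" "B \<noteq> A" "connected_coalition G A B" using cases by blast
    \<comment> \<open>The partner must survive the removal of the full singletons, for otherwise its
      lift would not be a class of \<open>?\<Psi>\<close>.\<close>
    have "B \<notin> ?S"
    proof
      assume "B \<in> ?S"
      then have "connected_dominating_set G B"
        using G.connected_dominating_set_full G.full_vertex_in_pverts by fastforce
      then show False using B by (simp add: connected_coalition_def)
    qed
    then have "B \<times> pverts H \<in> ?\<Psi>" using B by blast
    moreover have "B \<times> pverts H \<noteq> A'" using A B nonempty_H by (auto simp: times_eq_iff)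
    ultimately show "\<exists>B'\<in>?\<Psi>. B' \<noteq> A' \<and> connected_coalition (G \<box> H) A' B'"
      using connected_coalition_times[OF B(3)] A by blast
  qed simp
  moreover have "card ?S = card ?F" by (rule card_image) simp
  moreover have "card \<Phi> = card (\<Phi> - ?S) + card ?S"
  proof -
    have "finite \<Phi>" using G.pair_finite_verts part by (rule finite_elements)
    then show ?thesis using S card_mono[OF _ S] finite_subset[OF S]
      by (simp add: card_Diff_subset)
  qed
  ultimately show ?thesis using inj by (simp add: card_image)
qed

text \<open>For \<open>k > 0\<close> full vertices, the checkerboard pair and the
  \<open>k - 1\<close> remaining fibres give \<open>2 + 2 * (k - 1) = 2 * k\<close> classes, which
  is at least \<open>k\<close>. The vertex \<open>u\<close> makes \<open>U\<close> nonempty.\<close>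

lemma full_le_CC_of_not_full:
  assumes u: "u \<in> pverts G" "\<not> full_vertex G u"
  shows "card {v. full_vertex G v} \<le> CC (G \<box> H)"
proof (cases "{v. full_vertex G v} = {}")
  case False
  let ?F = "{v. full_vertex G v}"
  obtain v where v: "full_vertex G v" using False by blast
  then have vG: "v \<in> pverts G" by (rule G.full_vertex_in_pverts)
  obtain h where h: "h \<in> pverts H" using nonempty_H by blast
  define U where "U = pverts G - ?F"
  define C where "C = pverts H - {h}"
  have "card C \<ge> 1" using cardH h H.pair_finite_verts by (simp add: C_def)
  then have "C \<noteq> {}" by auto
  then have C: "{h} \<union> C = pverts H" "{h} \<inter> C = {}" "C \<noteq> {}"
    using h by (auto simp: C_def)
  let ?X = "{v} \<times> {h} \<union> U \<times> C"
  let ?Y = "{v} \<times> C \<union> U \<times> {h}"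
  have U: "U \<subseteq> pverts G" "v \<notin> U" "U \<noteq> {}"
    using u v by (auto simp: U_def)
  have XY: "connected_coalition (G \<box> H) ?X ?Y"
    using v U C by (intro connected_coalition_checkerboard) auto
  \<comment> \<open>The vertex \<open>(v, h)\<close> separates the two sets, so the pair really
    counts as two classes.\<close>
  have "(v, h) \<in> ?X" "(v, h) \<notin> ?Y" using C U by auto
  then have neq: "?X \<noteq> ?Y" by metis
  have "card {?X, ?Y} + 2 * card (?F - {v}) \<le> CC (G \<box> H)"
  proof (rule card_plus_fibres_le_CC)
    show "partition_on ((pverts G - (?F - {v})) \<times> pverts H) {?X, ?Y}"
    proof (rule partition_onI)
      have "pverts G - (?F - {v}) = insert v U" using v vG by (auto simp: U_def)
      then show "\<Union>{?X, ?Y} = (pverts G - (?F - {v})) \<times> pverts H" using C(1) by auto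
      have "disjnt ?X ?Y" using U C by (auto simp: disjnt_def)
      then show "disjnt p q" if "p \<in> {?X, ?Y}" "q \<in> {?X, ?Y}" "p \<noteq> q" for p q
        using that by (auto simp: disjnt_sym)
      show "{} \<notin> {?X, ?Y}" using C by auto
    qed
    show "\<exists>B\<in>{?X, ?Y}. B \<noteq> A \<and> connected_coalition (G \<box> H) A B" if "A \<in> {?X, ?Y}" for A
      using that XY neq connected_coalition_commute by (metis insert_iff singletonD)
  qed simp
  moreover have "card ?F = Suc (card (?F - {v}))"
    using v G.finite_full_vertices by (intro card.remove) auto
  ultimately show ?thesis using neq by simp
next
  case True
  then show ?thesis by simp
qed

lemma CC_plus_full_le_CC: "CC G + card {v. full_vertex G v} \<le> CC (G \<box> H)"
proof (cases "\<exists>\<Phi>. connected_coalition_partition G \<Phi>")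
  case True
  then show ?thesis
    using CC_attained[OF G.pair_finite_verts] CC_plus_full_le_CC_of_partition by metis
next
  case False
  \<comment> \<open>If all vertices were full, the partition into singletons would qualify; hence
    some vertex is not full.\<close>
  have "\<not> connected_coalition_partition G ((\<lambda>v. {v}) ` pverts G)" using False by blast
  then obtain u where "u \<in> pverts G" "\<not> full_vertex G u"
    using partition_on_singletons[of "pverts G"]
    by (auto simp: connected_coalition_partition_def)
  then have "card {v. full_vertex G v} \<le> CC (G \<box> H)"
    by (rule full_le_CC_of_not_full)
  moreover have "CC G = 0" unfolding CC_def using False by (rule if_not_P)
  ultimately show ?thesis by simp
qed

end

section \<open>Commutativity of the product\<close>

lemma swap_arcs_cart_prod:
  "(prod.swap x, prod.swap y) \<in> parcs (H \<box> G) \<longleftrightarrow> (x, y) \<in> parcs (G \<box> H)"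
  by (cases x; cases y) auto

lemma swap_image_swap_image [simp]: "prod.swap ` prod.swap ` S = S"
  by (simp add: image_image)

text \<open>Undominated vertices and closed sets are pulled back along the swap, where the
  hypotheses on \<open>S\<close> apply.\<close>

lemma connected_dominating_set_swapI:
  assumes "pair_graph G" "pair_graph H" and S: "connected_dominating_set (G \<box> H) S"
  shows "connected_dominating_set (H \<box> G) (prod.swap ` S)"
proof -
  interpret GH: pair_graph "G \<box> H" by (rule pair_graph_cart_prod) fact+
  interpret HG: pair_graph "H \<box> G" by (rule pair_graph_cart_prod) fact+
  have dom: "dominating_set (G \<box> H) S" and conn: "connected (with_proj (G \<box> H) \<restriction> S)"
    using S by (auto simp: connected_dominating_set_def)
  have "dominating_set (H \<box> G) (prod.swap ` S)"
    unfolding dominating_set_def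
  proof (intro conjI ballI)
    show "prod.swap ` S \<subseteq> pverts (H \<box> G)"
      using dom by (auto simp: dominating_set_def)
    fix y assume y: "y \<in> pverts (H \<box> G) - prod.swap ` S"
    have "prod.swap y \<in> pverts (G \<box> H) - S"
      using y by (cases y) force
    then obtain x where "x \<in> S" "(prod.swap y, x) \<in> parcs (G \<box> H)"
      using dom unfolding dominating_set_def by blast
    then show "\<exists>x\<in>prod.swap ` S. (y, x) \<in> parcs (H \<box> G)"
      using swap_arcs_cart_prod[of "prod.swap y" x H G] by auto
  qed
  moreover have "connected (with_proj (H \<box> G) \<restriction> (prod.swap ` S))"
  proof (rule HG.connected_induceI)
    show "prod.swap ` S \<noteq> {}" using conn by (simp add: GH.connected_induce_iff)
    fix Q w
    assume Q: "Q \<subseteq> prod.swap ` S" "w \<in> Q"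
      "\<And>u v. \<lbrakk>u \<in> Q; v \<in> prod.swap ` S; (u, v) \<in> parcs (H \<box> G)\<rbrakk> \<Longrightarrow> v \<in> Q"
    have "prod.swap ` Q = S"
      using conn
    proof (rule GH.connected_induceD)
      show "prod.swap ` Q \<subseteq> S" using image_mono[OF Q(1), of prod.swap] by simp
      show "prod.swap w \<in> prod.swap ` Q" using Q(2) by simp
      fix u v assume uv: "u \<in> prod.swap ` Q" "v \<in> S" "(u, v) \<in> parcs (G \<box> H)"
      have "prod.swap v \<in> Q"
        by (rule Q(3)[of "prod.swap u"]) (use uv in \<open>auto simp: swap_arcs_cart_prod\<close>)
      then show "v \<in> prod.swap ` Q" by (metis image_eqI swap_swap)
    qed
    then show "prod.swap ` S \<subseteq> Q" by (metis order_refl swap_image_swap_image)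
  qed
  ultimately show ?thesis by (simp add: connected_dominating_set_def)
qed

lemma connected_coalition_swapI:
  assumes GH: "pair_graph G" "pair_graph H" and "connected_coalition (G \<box> H) A B"
  shows "connected_coalition (H \<box> G) (prod.swap ` A) (prod.swap ` B)"
proof -
  \<comment> \<open>The converse is the same implication with \<open>G\<close> and \<open>H\<close>
    exchanged, because swapping twice is the identity. The equivalence is needed to carry over the
    negative conditions.\<close>
  have "connected_dominating_set (H \<box> G) (prod.swap ` S) \<longleftrightarrow> connected_dominating_set (G \<box> H) S"
    for S
    using connected_dominating_set_swapI[OF GH, of S]
      connected_dominating_set_swapI[OF GH(2,1), of "prod.swap ` S"] by auto
  moreover have "prod.swap ` A \<inter> prod.swap ` B = prod.swap ` (A \<inter> B)"
    by (simp add: image_Int)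
  ultimately show ?thesis
    using assms(3) by (auto simp: connected_coalition_def simp flip: image_Un)
qed

lemma full_vertex_swapI:
  assumes "full_vertex (G \<box> H) v"
  shows "full_vertex (H \<box> G) (prod.swap v)"
proof -
  have "out_arcs (with_proj (H \<box> G)) (prod.swap v) =
      map_prod prod.swap prod.swap ` out_arcs (with_proj (G \<box> H)) v"
    by (cases v) (auto simp: out_arcs_def image_iff)
  moreover have "inj (map_prod prod.swap prod.swap)" by (intro prod.inj_map) auto
  ultimately have "out_degree (with_proj (H \<box> G)) (prod.swap v) = out_degree (with_proj (G \<box> H)) v"
    by (metis out_degree_def card_image inj_on_subset subset_UNIV)
  then show ?thesis
    using assms by (cases v) (auto simp: full_vertex_def card_cartesian_product mult.commute)
qed

text \<open>The swapped image of an optimal partition is again a coalition partition, of the same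
  size because the swap is injective. This inequality carries the bound for
  \<open>H \<box> G\<close> over to \<open>G \<box> H\<close>.\<close>

lemma CC_cart_prod_commute_le:
  assumes GH: "pair_graph G" "pair_graph H"
  shows "CC (G \<box> H) \<le> CC (H \<box> G)"
proof (cases "\<exists>\<Phi>. connected_coalition_partition (G \<box> H) \<Phi>")
  case True
  interpret GH: pair_graph "G \<box> H" using GH by (rule pair_graph_cart_prod)
  interpret HG: pair_graph "H \<box> G" using GH(2,1) by (rule pair_graph_cart_prod)
  obtain \<Phi> where \<Phi>: "connected_coalition_partition (G \<box> H) \<Phi>" "card \<Phi> = CC (G \<box> H)"
    using CC_attained[OF GH.pair_finite_verts True] by blast
  let ?\<Psi> = "(`) prod.swap ` \<Phi>"
  have part: "partition_on (pverts (G \<box> H)) \<Phi>"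
    and cases: "\<And>A. A \<in> \<Phi> \<Longrightarrow> (\<exists>v. full_vertex (G \<box> H) v \<and> A = {v}) \<or>
      (\<exists>B\<in>\<Phi>. B \<noteq> A \<and> connected_coalition (G \<box> H) A B)"
    using \<Phi>(1) unfolding connected_coalition_partition_def by simp_all
  have "partition_on (prod.swap ` pverts (G \<box> H)) (?\<Psi> - {{}})"
    using part by (rule partition_on_inj_image) simp
  \<comment> \<open>The image rule for partitions discards an empty class; none arises here, so the
    subtraction of \<open>{{}}\<close> is harmless.\<close>
  moreover have "{} \<notin> ?\<Psi>" using part by (auto simp: partition_on_def)
  moreover have "prod.swap ` pverts (G \<box> H) = pverts (H \<box> G)" by (simp add: product_swap)
  ultimately have "partition_on (pverts (H \<box> G)) ?\<Psi>" by simp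
  moreover have "(\<exists>v. full_vertex (H \<box> G) v \<and> prod.swap ` A = {v}) \<or>
      (\<exists>B\<in>?\<Psi>. B \<noteq> prod.swap ` A \<and> connected_coalition (H \<box> G) (prod.swap ` A) B)"
    if A: "A \<in> \<Phi>" for A
  proof (cases "\<exists>v. full_vertex (G \<box> H) v \<and> A = {v}")
    case True
    then obtain v where "full_vertex (G \<box> H) v" "A = {v}" by blast
    then have "full_vertex (H \<box> G) (prod.swap v)" "prod.swap ` A = {prod.swap v}"
      by (simp_all add: full_vertex_swapI)
    then show ?thesis by blast
  next
    case False
    then obtain B where "B \<in> \<Phi>" "B \<noteq> A" "connected_coalition (G \<box> H) A B"
      using cases[OF A] by blast
    then have "connected_coalition (H \<box> G) (prod.swap ` A) (prod.swap ` B)"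
      using GH by (blast intro: connected_coalition_swapI)
    moreover have "prod.swap ` B \<noteq> prod.swap ` A"
      using \<open>B \<noteq> A\<close> by (simp add: inj_image_eq_iff)
    ultimately show ?thesis
      using \<open>B \<in> \<Phi>\<close> by (intro disjI2 bexI[where x = "prod.swap ` B"] conjI imageI)
  qed
  ultimately have "connected_coalition_partition (H \<box> G) ?\<Psi>"
    unfolding connected_coalition_partition_def by (intro conjI ballI) (assumption, erule imageE, simp only:)
  then have "card ?\<Psi> \<le> CC (H \<box> G)" by (rule card_le_CC[OF HG.pair_finite_verts])
  moreover have "card ?\<Psi> = card \<Phi>"
    by (intro card_image inj_onI) (simp add: inj_image_eq_iff)
  ultimately show ?thesis using \<Phi> by simp
next
  case False
  then have "CC (G \<box> H) = 0" unfolding CC_def by (rule if_not_P)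
  then show ?thesis by simp
qed

theorem theorem4p1:
  fixes G :: "'a pair_pre_digraph" and H :: "'b pair_pre_digraph"
  assumes "pair_graph G" and "pair_graph H"
    and "connected (with_proj G)" and "connected (with_proj H)"
    and "card (pverts G) \<ge> 2" and "card (pverts H) \<ge> 2"
  shows "CC (G \<box> H) \<ge> max (CC G + card {v. full_vertex G v}) (CC H + card {v. full_vertex H v})"
proof -
  interpret G: pair_graph G by fact
  interpret H: pair_graph H by fact
  interpret GH: graph_pair G H by unfold_locales (use assms in auto)
  interpret HG: graph_pair H G by unfold_locales (use assms in auto)
  show ?thesis
    using GH.CC_plus_full_le_CC HG.CC_plus_full_le_CC CC_cart_prod_commute_le[OF assms(2,1)]
    by simp
qed

end
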